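(* Let $p(z)=\sum_{j=0}^{n}a_jz^j$, with $a_0\neq 0$, be a polynomial of degree $n$ with complex coefficients, and write $\alpha_j=\operatorname{Re}(a_j)$ and $\beta_j=\operatorname{Im}(a_j)$ for $0\le j\le n$. Suppose that for some real number $t$ and some $\lambda\in\{0,1,2,\ldots,n\}$, $$t+\alpha_{n}\leq \alpha_{n-1}\leq \cdots\leq\alpha_{\lambda}\geq\alpha_{\lambda-1}\geq\alpha_{\lambda-2}\geq\cdots\geq\alpha_{1}\geq\alpha_{0}.$$ Then for every $\delta$ with $0<\delta<1$, the number of zeros of $p$ in the disk $|z|\leq\delta$ does not exceed $$\frac{1}{\log (1/\delta)}\log\frac{M_1}{|a_0|},$$ where $$M_1=|\alpha_0|-\alpha_0+|\alpha_n|-\alpha_n+|t|-t+2\alpha_{\lambda}+2\sum_{j=0}^{n}|\beta_j|.$$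
   Context: Zeros are counted with multiplicity. The displayed chain of inequalities means: the sequence $t+\alpha_n,\alpha_{n-1},\ldots,\alpha_{\lambda}$ is nondecreasing and the sequence $\alpha_\lambda,\alpha_{\lambda-1},\ldots,\alpha_0$ is nonincreasing. In the boundary case $\lambda=n$ the left part is read as $t+\alpha_n\le\alpha_n$, and in the boundary case $\lambda=0$ the right part is vacuous. *)

theory Defs
  imports Complex_Main "HOL-Computational_Algebra.Polynomial"
begin

(* Zeros of p in the closed disk of radius r, counted with multiplicity.
   For p = 0 the value is meaningless: the sum then ranges over an infinite set. *)
definition zeros_in_disk :: "complex poly \<Rightarrow> real \<Rightarrow> nat" where
  "zeros_in_disk p r = (\<Sum>z | poly p z = 0 \<and> cmod z \<le> r. order z p)"

end

theory Submission
  imports Defs "HOL-Computational_Algebra.Fundamental_Theorem_Algebra"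
    "HOL-Complex_Analysis.Conformal_Mappings"
begin

text \<open>
  Two ingredients give the bound. The first is Jensen's inequality on the unit disk: if a
  polynomial \<open>f\<close> satisfies \<open>|f| \<le> M\<close> on the unit circle, each zero \<open>a\<close> in \<open>|z| \<le> \<delta>\<close> can be
  reflected, that is, its factor \<open>z - a\<close> can be replaced by \<open>1 - cnj a * z\<close>. This does not change
  the modulus on the circle, but at the origin it turns a factor of modulus \<open>|a| \<le> \<delta>\<close> into
  \<open>1\<close>. The maximum modulus principle bounds the new polynomial at \<open>0\<close> by \<open>M\<close>, so that
  \<open>|f 0| \<le> M * \<delta> ^ N\<close> when there are \<open>N\<close> such zeros (lemma \<open>jensen_zeros_in_disk\<close>).

  The second, going back to Enestroem and Kakeya, is to apply this to \<open>(1 - z) * p z\<close> rather than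
  to \<open>p\<close>. The new factor has modulus at least \<open>1 - \<delta>\<close> in the small disk, so it adds no zeros
  there, and it keeps the value at the origin. But the coefficients of the product are the
  differences of consecutive coefficients of \<open>p\<close>: the monotonicity hypotheses make the absolute
  values of the differences of the real parts telescope, and the sum of the moduli of all
  coefficients is at most \<open>M\<^sub>1\<close>.
\<close>

section \<open>Counting zeros by reflection in the unit circle\<close>

lemma cmod_reflected_factor:
  assumes "cmod z = 1"
  shows "cmod (1 - cnj a * z) = cmod (z - a)"
proof -
  have "z * cnj z = 1"
    using assms by (simp add: complex_norm_square[symmetric])
  then have "1 - cnj a * z = z * cnj (z - a)"
    by (simp add: algebra_simps)
  then show ?thesis
    using assms by (simp only: norm_mult complex_mod_cnj)
qed

text \<open>
  The auxiliary polynomial \<open>g\<close> below is \<open>f\<close> divided by the Blaschke product of its zeros in the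
  smaller disk. Written as a product over all zeros, it is defined also on the circle itself
  and at the zeros, with no singularities to remove.
\<close>

lemma jensen_zeros_in_disk:
  fixes f :: "complex poly"
  assumes "f \<noteq> 0" and "0 < r" and "r < 1"
    and bound: "\<And>z. cmod z = 1 \<Longrightarrow> cmod (poly f z) \<le> M"
  shows "cmod (poly f 0) \<le> M * r ^ zeros_in_disk f r"
proof -
  define Z where "Z = {z. poly f z = 0}"
  define S where "S = {z. poly f z = 0 \<and> cmod z \<le> r}"
  have fin: "finite Z" "finite S" and "S \<subseteq> Z"
    using poly_roots_finite[OF \<open>f \<noteq> 0\<close>] by (auto simp: Z_def S_def)
  define h where "h z = lead_coeff f * (\<Prod>a\<in>Z - S. (z - a) ^ order a f)" for z
  define g where "g z = h z * (\<Prod>a\<in>S. (1 - cnj a * z) ^ order a f)" for z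
  have f_eq: "poly f z = h z * (\<Prod>a\<in>S. (z - a) ^ order a f)" for z
  proof -
    have "poly f z = lead_coeff f * (\<Prod>a\<in>Z. (z - a) ^ order a f)"
      by (subst complex_poly_decompose[of f, symmetric])
         (simp add: Z_def poly_prod poly_power)
    also have "(\<Prod>a\<in>Z. (z - a) ^ order a f) =
        (\<Prod>a\<in>Z - S. (z - a) ^ order a f) * (\<Prod>a\<in>S. (z - a) ^ order a f)"
      by (rule prod.subset_diff[OF \<open>S \<subseteq> Z\<close> fin(1)])
    finally show ?thesis
      by (simp add: h_def)
  qed
  have g_circle: "cmod (g z) \<le> M" if "cmod z = 1" for z
  proof -
    have "cmod (g z) = cmod (poly f z)"
      using that by (simp add: g_def f_eq norm_mult norm_power cmod_reflected_factor
          flip: prod_norm)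
    then show ?thesis
      using bound[OF that] by simp
  qed
  have g_hol: "g holomorphic_on UNIV"
    unfolding g_def h_def by (intro holomorphic_intros)
  have g0: "cmod (g 0) \<le> M"
  proof (rule maximum_modulus_frontier[of g "cball 0 1"])
    show "g holomorphic_on interior (cball 0 1)"
      using g_hol by (rule holomorphic_on_subset) simp
    show "continuous_on (closure (cball 0 1)) g"
      using holomorphic_on_imp_continuous_on[OF g_hol] by (rule continuous_on_subset) simp
    show "cmod (g z) \<le> M" if "z \<in> frontier (cball 0 1)" for z
      using that by (intro g_circle) (simp add: frontier_cball)
  qed auto
  have "cmod (\<Prod>a\<in>S. (0 - a) ^ order a f) = (\<Prod>a\<in>S. cmod a ^ order a f)"
    by (simp add: norm_power flip: prod_norm)
  also have "\<dots> \<le> (\<Prod>a\<in>S. r ^ order a f)"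
    by (rule prod_mono) (auto simp: S_def intro: power_mono)
  also have "\<dots> = r ^ zeros_in_disk f r"
    by (simp add: zeros_in_disk_def S_def power_sum)
  finally have small: "cmod (\<Prod>a\<in>S. (0 - a) ^ order a f) \<le> r ^ zeros_in_disk f r" .
  have "cmod (poly f 0) = cmod (g 0) * cmod (\<Prod>a\<in>S. (0 - a) ^ order a f)"
    by (simp only: f_eq norm_mult) (simp add: g_def)
  also have "\<dots> \<le> M * r ^ zeros_in_disk f r"
    using g0 small by (rule mult_mono) (use g0 norm_ge_zero[of "g 0"] in linarith, simp)
  finally show ?thesis .
qed

lemma zeros_in_disk_le_log:
  fixes f :: "complex poly"
  assumes f0: "poly f 0 \<noteq> 0" and r: "0 < r" "r < 1"
    and bound: "\<And>z. cmod z = 1 \<Longrightarrow> cmod (poly f z) \<le> M"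
  shows "real (zeros_in_disk f r) \<le> 1 / ln (1 / r) * ln (M / cmod (poly f 0))"
proof -
  let ?N = "zeros_in_disk f r"
  have "f \<noteq> 0"
    using f0 by auto
  then have jensen: "cmod (poly f 0) \<le> M * r ^ ?N"
    using r bound by (rule jensen_zeros_in_disk)
  have "(1 / r) ^ ?N \<le> M / cmod (poly f 0)"
    using jensen r f0 by (simp add: field_simps)
  then have "ln ((1 / r) ^ ?N) \<le> ln (M / cmod (poly f 0))"
    using r by (intro ln_mono) auto
  then have "real ?N * ln (1 / r) \<le> ln (M / cmod (poly f 0))"
    using r by (subst (asm) ln_realpow) auto
  moreover have "ln (1 / r) > 0"
    using r by simp
  ultimately show ?thesis
    by (simp add: pos_le_divide_eq)
qed

section \<open>The multiplier \<open>1 - z\<close>\<close>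

lemma zeros_in_disk_mult_one_minus:
  assumes "p \<noteq> 0" and "r < 1"
  shows "zeros_in_disk ([:1, -1:] * p) r = zeros_in_disk p r"
  unfolding zeros_in_disk_def
proof (rule sum.cong)
  have ne: "poly [:1, -1:] z \<noteq> 0" if "cmod z \<le> r" for z :: complex
    using that \<open>r < 1\<close> by auto
  then show "{z. poly ([:1, -1:] * p) z = 0 \<and> cmod z \<le> r} = {z. poly p z = 0 \<and> cmod z \<le> r}"
    by (auto simp del: mult_pCons_left)
  fix z assume "z \<in> {z. poly p z = 0 \<and> cmod z \<le> r}"
  then have "order z [:1, -1:] = 0"
    using ne by (intro order_0I) auto
  moreover have "[:1, -1:] * p \<noteq> 0"
    using \<open>p \<noteq> 0\<close> by (simp only: mult_eq_0_iff) simp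
  ultimately show "order z ([:1, -1:] * p) = order z p"
    by (subst order_mult) auto
qed

lemma one_minus_mult_power_sum:
  fixes a :: "nat \<Rightarrow> 'a::comm_ring_1"
  shows "(1 - z) * (\<Sum>j\<le>n. a j * z ^ j) =
    a 0 + (\<Sum>j<n. (a (Suc j) - a j) * z ^ Suc j) - a n * z ^ Suc n"
  by (induction n) (simp_all add: algebra_simps)

lemma cmod_one_minus_mult_poly_le:
  assumes "cmod z = 1"
  shows "cmod (poly ([:1, -1:] * p) z) \<le>
    cmod (coeff p 0) + (\<Sum>j<degree p. cmod (coeff p (Suc j) - coeff p j)) + cmod (lead_coeff p)"
proof -
  let ?n = "degree p" and ?a = "coeff p"
  let ?D = "\<Sum>j<?n. (?a (Suc j) - ?a j) * z ^ Suc j"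
  have "poly ([:1, -1:] * p) z = (1 - z) * (\<Sum>j\<le>?n. ?a j * z ^ j)"
    by (simp only: poly_mult poly_altdef[of p]) simp
  also have "\<dots> = ?a 0 + ?D - ?a ?n * z ^ Suc ?n"
    by (rule one_minus_mult_power_sum[of z ?a ?n])
  finally have "poly ([:1, -1:] * p) z = ?a 0 + ?D - ?a ?n * z ^ Suc ?n" .
  then have "cmod (poly ([:1, -1:] * p) z) \<le> cmod (?a 0) + cmod ?D + cmod (?a ?n * z ^ Suc ?n)"
    by (simp only: order.trans[OF norm_triangle_ineq4 add_right_mono[OF norm_triangle_ineq]])
  moreover have "cmod ?D \<le> (\<Sum>j<?n. cmod (?a (Suc j) - ?a j))"
    by (rule order.trans[OF norm_sum]) (simp add: norm_mult norm_power assms)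
  moreover have "cmod (?a ?n * z ^ Suc ?n) = cmod (?a ?n)"
    by (simp add: norm_mult norm_power assms)
  ultimately show ?thesis
    by linarith
qed

section \<open>Variation of the coefficients\<close>

text \<open>
  Up to the peak the differences telescope to \<open>u l - u 0\<close>, after it to \<open>u l - u (n - 1)\<close>. The
  sign of the last difference is not known, only that of \<open>t + u n - u (n - 1)\<close>; separating
  \<open>t\<close> from it costs the term \<open>\<bar>t\<bar>\<close>. For \<open>l = n\<close> there is no descent, and
  the nonnegative amount \<open>\<bar>t\<bar> - t\<close> only weakens the bound.
\<close>

lemma variation_unimodal_shifted:
  fixes u :: "nat \<Rightarrow> real"
  assumes "l \<le> n"
    and top_less: "l < n \<Longrightarrow> t + u n \<le> u (n - 1)"
    and decr: "\<And>j. l \<le> j \<Longrightarrow> j + 1 < n \<Longrightarrow> u (j + 1) \<le> u j"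
    and incr: "\<And>j. j < l \<Longrightarrow> u j \<le> u (j + 1)"
  shows "(\<Sum>j<n. \<bar>u (Suc j) - u j\<bar>) \<le> 2 * u l - u 0 - u n + \<bar>t\<bar> - t"
proof -
  have "(\<Sum>j<l. \<bar>u (Suc j) - u j\<bar>) = (\<Sum>j<l. u (Suc j) - u j)"
    using incr by (intro sum.cong) auto
  then have rise: "(\<Sum>j<l. \<bar>u (Suc j) - u j\<bar>) = u l - u 0"
    by (simp add: sum_lessThan_telescope)
  show ?thesis
  proof (cases "l = n")
    case True
    then show ?thesis
      using rise by auto
  next
    case False
    then obtain m where m: "n = Suc m" "l \<le> m"
      using \<open>l \<le> n\<close> by (cases n) auto
    have "(\<Sum>j=l..<m. \<bar>u (Suc j) - u j\<bar>) = (\<Sum>j=l..<m. - (u (Suc j) - u j))"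
      using decr m by (intro sum.cong) auto
    also have "\<dots> = u l - u m"
      using sum_Suc_diff'[OF m(2), of u] by (simp only: sum_negf)
    finally have fall: "(\<Sum>j=l..<m. \<bar>u (Suc j) - u j\<bar>) = u l - u m" .
    have "{..<n} = insert m ({..<l} \<union> {l..<m})"
      using m by auto
    then have "(\<Sum>j<n. \<bar>u (Suc j) - u j\<bar>) =
        \<bar>u n - u m\<bar> + ((\<Sum>j<l. \<bar>u (Suc j) - u j\<bar>) + (\<Sum>j=l..<m. \<bar>u (Suc j) - u j\<bar>))"
      using m by (simp add: sum.union_disjoint ivl_disj_int)
    then show ?thesis
      using rise fall top_less m by auto
  qed
qed

text \<open>
  For the imaginary parts, which follow no order, the triangle inequality has to do. It uses
  every inner entry twice and each end once; the two end terms make up the difference.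
\<close>

lemma variation_with_ends_le:
  fixes v :: "nat \<Rightarrow> real"
  shows "\<bar>v 0\<bar> + (\<Sum>j<n. \<bar>v (Suc j) - v j\<bar>) + \<bar>v n\<bar> \<le> 2 * (\<Sum>j=0..n. \<bar>v j\<bar>)"
  by (induction n) auto

theorem theorem1:
  fixes p :: "complex poly" and n l :: nat
    and \<alpha> \<beta> :: "nat \<Rightarrow> real" and t \<delta> M\<^sub>1 :: real
  assumes deg: "degree p = n"
    and a0: "coeff p 0 \<noteq> 0"
    and alpha: "\<And>j. j \<le> n \<Longrightarrow> \<alpha> j = Re (coeff p j)"
    and beta: "\<And>j. j \<le> n \<Longrightarrow> \<beta> j = Im (coeff p j)"
    and l: "l \<le> n"
    and top_eq: "l = n \<Longrightarrow> t + \<alpha> n \<le> \<alpha> n"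
    and top_less: "l < n \<Longrightarrow> t + \<alpha> n \<le> \<alpha> (n - 1)"
    and left: "\<And>j. l \<le> j \<Longrightarrow> j + 1 < n \<Longrightarrow> \<alpha> (j + 1) \<le> \<alpha> j"
    and right: "\<And>j. j < l \<Longrightarrow> \<alpha> j \<le> \<alpha> (j + 1)"
    and delta: "0 < \<delta>" "\<delta> < 1"
    and M1: "M\<^sub>1 = \<bar>\<alpha> 0\<bar> - \<alpha> 0 + \<bar>\<alpha> n\<bar> - \<alpha> n + \<bar>t\<bar> - t + 2 * \<alpha> l + 2 * (\<Sum>j=0..n. \<bar>\<beta> j\<bar>)"
  shows "real (zeros_in_disk p \<delta>) \<le> 1 / ln (1 / \<delta>) * ln (M\<^sub>1 / cmod (coeff p 0))"
proof -
  let ?F = "[:1, -1:] * p"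
  have "p \<noteq> 0"
    using a0 by auto
  have F0: "poly ?F 0 = coeff p 0"
    by (simp add: poly_0_coeff_0)
  have "cmod (poly ?F z) \<le> M\<^sub>1" if "cmod z = 1" for z
  proof -
    have coeff_le: "cmod (coeff p j) \<le> \<bar>\<alpha> j\<bar> + \<bar>\<beta> j\<bar>" if "j \<le> n" for j
      using cmod_le[of "coeff p j"] alpha[OF that] beta[OF that] by simp
    have "(\<Sum>j<n. cmod (coeff p (Suc j) - coeff p j)) \<le>
        (\<Sum>j<n. \<bar>\<alpha> (Suc j) - \<alpha> j\<bar> + \<bar>\<beta> (Suc j) - \<beta> j\<bar>)"
    proof (rule sum_mono)
      fix j assume "j \<in> {..<n}"
      then show "cmod (coeff p (Suc j) - coeff p j) \<le> \<bar>\<alpha> (Suc j) - \<alpha> j\<bar> + \<bar>\<beta> (Suc j) - \<beta> j\<bar>"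
        using cmod_le[of "coeff p (Suc j) - coeff p j"] by (simp add: alpha beta)
    qed
    also have "\<dots> = (\<Sum>j<n. \<bar>\<alpha> (Suc j) - \<alpha> j\<bar>) + (\<Sum>j<n. \<bar>\<beta> (Suc j) - \<beta> j\<bar>)"
      by (rule sum.distrib)
    finally show ?thesis
      using cmod_one_minus_mult_poly_le[OF \<open>cmod z = 1\<close>, of p] coeff_le[of 0] coeff_le[of n]
        variation_unimodal_shifted[OF l top_less left right]
        variation_with_ends_le[of \<beta> n]
      unfolding M1 deg by simp
  qed
  then have "real (zeros_in_disk ?F \<delta>) \<le> 1 / ln (1 / \<delta>) * ln (M\<^sub>1 / cmod (poly ?F 0))"
    using F0 a0 delta by (intro zeros_in_disk_le_log) simp_all
  then show ?thesis
    unfolding zeros_in_disk_mult_one_minus[OF \<open>p \<noteq> 0\<close> delta(2)] F0 .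
qed

end
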